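(* Let $\mathbf{x}:\mathbb{Z}^2\to\mathbb{R}^{M+1}\setminus\{0\}$ satisfy $\mathbf{x}_{(12)}+\mathbf{x}=F_{(1)}\mathbf{x}_{(1)}+F_{(2)}\mathbf{x}_{(2)}$, let $\theta^1,\theta^2$ be two scalar solutions of the Moutard equation $\theta_{(12)}+\theta=F(\theta_{(1)}+\theta_{(2)})$, and let $\mathbf{x}^{(1)}$ and $\mathbf{x}^{(2)}$ be Koenigs transforms of $\mathbf{x}$ via $\theta^1$ and via $\theta^2$, respectively. Let $$\phi^1=\theta^1_{(1)}+\theta^1_{(2)},\quad \phi^2=\theta^2_{(1)}+\theta^2_{(2)},\quad \phi^{1(1)}=\frac1{\theta^1_{(1)}}+\frac1{\theta^1_{(2)}},\quad \phi^{2(2)}=\frac1{\theta^2_{(1)}}+\frac1{\theta^2_{(2)}}.$$ Let $\Xi:\mathbb{Z}^2\to\mathbb{R}$ be a solution (determined up to an additive constant) of $$\Delta_1\Xi=\theta^1\theta^1_{(1)}\Delta_1\left(\frac{\theta^2}{\theta^1}\right),\qquad \Delta_2\Xi=-\theta^1\theta^1_{(2)}\Delta_2\left(\frac{\theta^2}{\theta^1}\right),$$ and define $\theta^{2(1)}$, $\theta^{1(2)}$ by $\theta^1\theta^{2(1)}=-\theta^2\theta^{1(2)}=\Xi$, and $$\phi^{1(21)}=\frac{1}{\theta^{1(2)}_{(1)}}+\frac{1}{\theta^{1(2)}_{(2)}},\qquad \phi^{2(12)}=\frac{1}{\theta^{2(1)}_{(1)}}+\frac{1}{\theta^{2(1)}_{(2)}}.$$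 Then the lattices $\mathbf{x}^{(12)}$ of the one-parameter family (because of the free additive constant in $\Xi$) given by $$\mathbf{x}^{(12)}=-\frac{\Xi_{(1)}\Xi_{(2)}\,\phi^{1(21)}\phi^{2(12)}}{\phi^1\phi^2}\,\mathbf{x}+\frac{\phi^{1(21)}}{\phi^{1(1)}}\,\mathbf{x}^{(1)}+\frac{\phi^{2(12)}}{\phi^{2(2)}}\,\mathbf{x}^{(2)}$$ are simultaneously Koenigs transforms of $\mathbf{x}^{(1)}$ via $\theta^{2(1)}$ and Koenigs transforms of $\mathbf{x}^{(2)}$ via $\theta^{1(2)}$.
   Context: Notation: for a function $g$ on $\mathbb{Z}^2$, $g_{(1)}(n_1,n_2)=g(n_1+1,n_2)$, $g_{(2)}(n_1,n_2)=g(n_1,n_2+1)$, $g_{(12)}(n_1,n_2)=g(n_1+1,n_2+1)$; $\Delta_i g=g_{(i)}-g$. Subscripts in brackets denote lattice shifts, while superscripts (such as $\theta^1$, $\theta^{2(1)}$, $\phi^{1(21)}$, $\mathbf{x}^{(12)}$) are only labels, not powers or shifts. Koenigs transform: if $\mathbf{x}_{(12)}+\mathbf{x}=F_{(1)}\mathbf{x}_{(1)}+F_{(2)}\mathbf{x}_{(2)}$ and $\theta_{(12)}+\theta=F(\theta_{(1)}+\theta_{(2)})$ with the same $F$, and $\phi=\theta_{(1)}+\theta_{(2)}$, $\phi'=1/\theta_{(1)}+1/\theta_{(2)}$, then a Koenigs transform of $\mathbf{x}$ via $\theta$ is a solution $\mathbf{x}'$ of $$\Delta_1(\mathbf{x}'/\phi')=(\theta\theta_{(2)})_{(1)}\Delta_1(\mathbf{x}/\phi),\qquad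 \Delta_2(\mathbf{x}'/\phi')=-(\theta\theta_{(1)})_{(2)}\Delta_2(\mathbf{x}/\phi).$$ Such $\mathbf{x}'$ satisfies the same type of equation with $F$ replaced by $F'=F\,\theta_{(1)}\theta_{(2)}/(\theta\theta_{(12)})$. The functions $\theta^{2(1)}$ and $\theta^{1(2)}$ are Moutard transforms of $\theta^2$ via $\theta^1$ and of $\theta^1$ via $\theta^2$; it is known that they satisfy the Moutard equation with potentials $F^{(1)}=F\theta^1_{(1)}\theta^1_{(2)}/(\theta^1\theta^1_{(12)})$ and $F^{(2)}=F\theta^2_{(1)}\theta^2_{(2)}/(\theta^2\theta^2_{(12)})$, respectively. Genericity convention: all functions appearing in denominators are assumed to vanish nowhere; in particular $\theta^1,\theta^2,\phi^1,\phi^2,\Xi$, $\phi^{1(21)},\phi^{2(12)}$, $\theta^{2(1)}_{(1)}+\theta^{2(1)}_{(2)}$ and $\theta^{1(2)}_{(1)}+\theta^{1(2)}_{(2)}$ vanish nowhere. *)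

theory Defs
  imports "HOL-Analysis.Analysis"
begin

text \<open>Functions on \<open>\<int>\<^sup>2\<close> are curried functions of two integers. The discrete variable
  \<open>n\<^sub>1\<close> is the first argument and \<open>n\<^sub>2\<close> the second.\<close>

type_synonym 'a lattice = "int \<Rightarrow> int \<Rightarrow> 'a"

definition shift1 :: "'a lattice \<Rightarrow> 'a lattice" where
  "shift1 g = (\<lambda>m n. g (m + 1) n)"

definition shift2 :: "'a lattice \<Rightarrow> 'a lattice" where
  "shift2 g = (\<lambda>m n. g m (n + 1))"

definition shift12 :: "'a lattice \<Rightarrow> 'a lattice" where
  "shift12 g = (\<lambda>m n. g (m + 1) (n + 1))"

definition diff1 :: "'a::minus lattice \<Rightarrow> 'a lattice" where
  "diff1 g = (\<lambda>m n. shift1 g m n - g m n)"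

definition diff2 :: "'a::minus lattice \<Rightarrow> 'a lattice" where
  "diff2 g = (\<lambda>m n. shift2 g m n - g m n)"

definition nowhere_zero :: "'a::zero lattice \<Rightarrow> bool" where
  "nowhere_zero g \<longleftrightarrow> (\<forall>m n. g m n \<noteq> 0)"

definition koenigs_eq :: "real lattice \<Rightarrow> 'v::real_vector lattice \<Rightarrow> bool" where
  "koenigs_eq F x \<longleftrightarrow> (\<forall>m n.
     shift12 x m n + x m n
       = shift1 F m n *\<^sub>R shift1 x m n + shift2 F m n *\<^sub>R shift2 x m n)"

definition moutard_eq :: "real lattice \<Rightarrow> real lattice \<Rightarrow> bool" where
  "moutard_eq F \<theta> \<longleftrightarrow> (\<forall>m n.
     shift12 \<theta> m n + \<theta> m n = F m n * (shift1 \<theta> m n + shift2 \<theta> m n))"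

definition phi :: "real lattice \<Rightarrow> real lattice" where
  "phi \<theta> = (\<lambda>m n. shift1 \<theta> m n + shift2 \<theta> m n)"

definition phi' :: "real lattice \<Rightarrow> real lattice" where
  "phi' \<theta> = (\<lambda>m n. 1 / shift1 \<theta> m n + 1 / shift2 \<theta> m n)"

text \<open>\<open>x'\<close> is a Koenigs transform of \<open>x\<close> via \<open>\<theta>\<close>, where \<open>F\<close> is the common potential of \<open>x\<close>
  and \<open>\<theta>\<close>. The two non-vanishing conditions are the genericity assumption on the
  denominators; \<^term>\<open>phi' \<theta>\<close> is then nowhere zero as well, since it equals
  \<open>\<phi> / (\<theta>\<^bsub>(1)\<^esub> \<theta>\<^bsub>(2)\<^esub>)\<close>.\<close>

definition koenigs_transform ::
  "real lattice \<Rightarrow> real lattice \<Rightarrow> 'v::real_vector lattice \<Rightarrow> 'v lattice \<Rightarrow> bool" where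
  "koenigs_transform F \<theta> x x' \<longleftrightarrow>
     koenigs_eq F x \<and> moutard_eq F \<theta> \<and> nowhere_zero \<theta> \<and> nowhere_zero (phi \<theta>) \<and>
     (\<forall>m n. diff1 (\<lambda>m n. x' m n /\<^sub>R phi' \<theta> m n) m n
        = shift1 (\<lambda>m n. \<theta> m n * shift2 \<theta> m n) m n
            *\<^sub>R diff1 (\<lambda>m n. x m n /\<^sub>R phi \<theta> m n) m n) \<and>
     (\<forall>m n. diff2 (\<lambda>m n. x' m n /\<^sub>R phi' \<theta> m n) m n
        = - shift2 (\<lambda>m n. \<theta> m n * shift1 \<theta> m n) m n
            *\<^sub>R diff2 (\<lambda>m n. x m n /\<^sub>R phi \<theta> m n) m n)"

definition transformed_potential :: "real lattice \<Rightarrow> real lattice \<Rightarrow> real lattice" where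
  "transformed_potential F \<theta> =
     (\<lambda>m n. F m n * shift1 \<theta> m n * shift2 \<theta> m n / (\<theta> m n * shift12 \<theta> m n))"

definition Xi_system :: "real lattice \<Rightarrow> real lattice \<Rightarrow> real lattice \<Rightarrow> bool" where
  "Xi_system \<theta>1 \<theta>2 \<Xi> \<longleftrightarrow>
     (\<forall>m n. diff1 \<Xi> m n
        = \<theta>1 m n * shift1 \<theta>1 m n * diff1 (\<lambda>m n. \<theta>2 m n / \<theta>1 m n) m n) \<and>
     (\<forall>m n. diff2 \<Xi> m n
        = - (\<theta>1 m n * shift2 \<theta>1 m n * diff2 (\<lambda>m n. \<theta>2 m n / \<theta>1 m n) m n))"

end

theory Submission
  imports Defs
begin

text \<open>Write \<open>u = \<theta>\<^sup>1\<close>, \<open>v = \<theta>\<^sup>2\<close>, \<open>A = v\<^bsub>(1)\<^esub> \<Xi>\<^bsub>(2)\<^esub> + v\<^bsub>(2)\<^esub> \<Xi>\<^bsub>(1)\<^esub>\<close> and \<open>B = u\<^bsub>(1)\<^esub> \<Xi>\<^bsub>(2)\<^esub> + u\<^bsub>(2)\<^esub> \<Xi>\<^bsub>(1)\<^esub>\<close>.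
  Dividing the formula for \<open>x\<^sup>1\<^sup>2\<close> by the \<open>\<phi>'\<close> of \<open>\<theta>\<^sup>2\<^sup>(\<^sup>1\<^sup>)\<close> gives
  \<open>A x / (\<phi>\<^sup>1\<phi>\<^sup>2) - (A/B) y\<^sup>1 + y\<^sup>2\<close>, where \<open>y\<^sup>i\<close> is \<open>x\<^sup>(\<^sup>i\<^sup>)\<close> divided by the \<open>\<phi>'\<close> of \<open>\<theta>\<^sup>i\<close>. In the
  first direction put \<open>w = \<Xi>\<^bsub>(1)\<^esub> + v\<^bsub>(1)\<^esub> u\<^bsub>(12)\<^esub>\<close>. The Moutard equations make
  \<open>A + v\<^bsub>(1)\<^esub> v\<^bsub>(12)\<^esub> \<phi>\<^sup>1 = w \<phi>\<^sup>2\<close> and \<open>A u\<^bsub>(1)\<^esub> u\<^bsub>(12)\<^esub> + \<Xi>\<^bsub>(1)\<^esub> \<Xi>\<^bsub>(12)\<^esub> \<phi>\<^sup>1 = w B\<close> hold both at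
  a lattice point and, with the same \<open>v\<^bsub>(1)\<^esub>, v\<^bsub>(12)\<^esub>, u\<^bsub>(1)\<^esub>, u\<^bsub>(12)\<^esub>, \<Xi>\<^bsub>(1)\<^esub>, \<Xi>\<^bsub>(12)\<^esub>, w\<close>, at its neighbour;
  this cancels everything in the difference equation. The second direction is the same up to
  signs, and the two claims are exchanged by \<open>\<theta>\<^sup>1 \<leftrightarrow> \<theta>\<^sup>2\<close>, \<open>\<Xi> \<mapsto> -\<Xi>\<close>.\<close>

section \<open>Summation over the integers and potentials on the lattice\<close>

lemma int_shift_invariant_const:
  fixes g :: "int \<Rightarrow> 'a"
  assumes "\<And>n. g (n + 1) = g n"
  shows "g n = g 0"
proof (induction n rule: int_induct[where k = 0])
  case (step2 i)
  then show ?case using assms[of "i - 1"] by simp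
qed (simp_all add: assms)

lemma int_antidifference:
  fixes f :: "int \<Rightarrow> 'a::ab_group_add"
  shows "\<exists>S. S 0 = 0 \<and> (\<forall>n. S (n + 1) - S n = f n)"
proof -
  \<comment> \<open>At most one of the two sums is nonempty, so one formula covers both signs of
    \<open>n\<close>.\<close>
  let ?S = "\<lambda>n. (\<Sum>k\<in>{0..<n}. f k) - (\<Sum>k\<in>{n..<0}. f k)"
  have "?S (n + 1) - ?S n = f n" for n
  proof (cases "n \<ge> 0")
    case True
    then have "{0..<n+1} = insert n {0..<n}" by auto
    with True show ?thesis by simp
  next
    case False
    then have "{n..<0} = insert n {n+1..<0}" by auto
    with False show ?thesis by simp
  qed
  then show ?thesis by (intro exI[of _ ?S]) simp
qed

text \<open>Discrete Poincare lemma: sum \<open>a\<close> along the axis \<open>n = 0\<close>, then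
  \<open>b\<close> along each line of constant \<open>m\<close>.\<close>

lemma lattice_potential:
  fixes a b :: "'a::ab_group_add lattice"
  assumes closed: "\<And>m n. a m (n + 1) - a m n = b (m + 1) n - b m n"
  shows "\<exists>S. \<forall>m n. S (m + 1) n - S m n = a m n \<and> S m (n + 1) - S m n = b m n"
proof -
  obtain f where f: "\<And>m. f (m + 1) - f m = a m 0"
    using int_antidifference[of "\<lambda>m. a m 0"] by auto
  have "\<forall>m. \<exists>S. S 0 = 0 \<and> (\<forall>n. S (n + 1) - S n = b m n)"
    by (intro allI int_antidifference)
  then obtain h where h0: "\<And>m. h m 0 = 0" and h: "\<And>m n. h m (n + 1) - h m n = b m n"
    by metis
  define S where "S m n = f m + h m n" for m n
  have d2: "S m (n + 1) - S m n = b m n" for m n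
    using h by (simp add: S_def)
  have d1: "S (m + 1) n - S m n = a m n" for m n
  proof -
    \<comment> \<open>The defect of the first difference is constant in \<open>n\<close> by
      \<open>closed\<close> and vanishes on the axis.\<close>
    define D where "D n = S (m + 1) n - S m n - a m n" for n
    have "D (n + 1) = D n" for n
    proof -
      have "D (n + 1) - D n = (S (m + 1) (n + 1) - S (m + 1) n) - (S m (n + 1) - S m n)
        - (a m (n + 1) - a m n)"
        by (simp add: D_def algebra_simps)
      also have "\<dots> = 0" by (simp only: d2 closed) simp
      finally show ?thesis by simp
    qed
    then have "D n = D 0" by (rule int_shift_invariant_const)
    also have "\<dots> = 0" using f by (simp add: D_def S_def h0)
    finally show ?thesis by (simp add: D_def)
  qed
  from d1 d2 show ?thesis by blast
qed

lemma lattice_eq_up_to_const: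
  fixes S T :: "'a::ab_group_add lattice"
  assumes "\<And>m n. T (m + 1) n - T m n = S (m + 1) n - S m n"
    and "\<And>m n. T m (n + 1) - T m n = S m (n + 1) - S m n"
  shows "\<exists>c. \<forall>m n. T m n = S m n + c"
proof -
  define D where "D m n = T m n - S m n" for m n
  have "D (m + 1) n = D m n" for m n
    using assms(1)[of m n] by (simp add: D_def algebra_simps)
  then have 1: "D m n = D 0 n" for m n
    by (rule int_shift_invariant_const[where g = "\<lambda>m. D m n"])
  have "D m (n + 1) = D m n" for m n
    using assms(2)[of m n] by (simp add: D_def algebra_simps)
  then have 2: "D m n = D m 0" for m n
    by (rule int_shift_invariant_const)
  have "D m n = D 0 0" for m n
    using 1[of m n] 2[of 0 n] by simp
  then have "T m n = S m n + D 0 0" for m n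
    by (metis D_def diff_add_cancel add.commute)
  then show ?thesis by blast
qed

section \<open>The linear system for the potential\<close>

text \<open>Clearing denominators leaves 2x2 determinants in \<open>u\<close> and \<open>v\<close>,
  a polynomial form suited to \<open>algebra\<close>.\<close>

lemma Xi_system_iff:
  assumes "nowhere_zero u"
  shows "Xi_system u v X \<longleftrightarrow>
    (\<forall>m n. X (m + 1) n - X m n = u m n * v (m + 1) n - v m n * u (m + 1) n \<and>
           X m (n + 1) - X m n = v m n * u m (n + 1) - u m n * v m (n + 1))"
proof -
  have "u m n \<noteq> 0" for m n using assms by (simp add: nowhere_zero_def)
  then have "u m n * u m' n' * (v m' n' / u m' n' - v m n / u m n) = u m n * v m' n' - v m n * u m' n'"
    for m n m' n' by (simp add: field_simps)
  then show ?thesis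
    by (simp add: Xi_system_def diff1_def diff2_def shift1_def shift2_def all_conj_distrib)
qed

lemma Xi_system_solvable:
  assumes "moutard_eq F u" and "moutard_eq F v" and "nowhere_zero u"
  shows "\<exists>X0. \<forall>X. Xi_system u v X \<longleftrightarrow> (\<exists>c. \<forall>m n. X m n = X0 m n + c)"
proof -
  let ?a = "\<lambda>m n. u m n * v (m + 1) n - v m n * u (m + 1) n"
  let ?b = "\<lambda>m n. v m n * u m (n + 1) - u m n * v m (n + 1)"
  \<comment> \<open>With indices as shifts, the two sides differ by
    \<open>(u1 + u2)(v12 + v) - (v1 + v2)(u12 + u)\<close>, which is zero because \<open>u\<close>
    and \<open>v\<close> share \<open>F\<close>.\<close>
  have "?a m (n + 1) - ?a m n = ?b (m + 1) n - ?b m n" for m n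
  proof -
    have "u (m + 1) (n + 1) + u m n = F m n * (u (m + 1) n + u m (n + 1))"
      and "v (m + 1) (n + 1) + v m n = F m n * (v (m + 1) n + v m (n + 1))"
      using assms by (simp_all add: moutard_eq_def shift1_def shift2_def shift12_def)
    then show ?thesis by algebra
  qed
  then obtain X0 where X0: "\<And>m n. X0 (m + 1) n - X0 m n = ?a m n"
      "\<And>m n. X0 m (n + 1) - X0 m n = ?b m n"
    using lattice_potential[of ?a ?b] by metis
  have "Xi_system u v X \<longleftrightarrow> (\<exists>c. \<forall>m n. X m n = X0 m n + c)" for X
  proof
    assume "Xi_system u v X"
    then show "\<exists>c. \<forall>m n. X m n = X0 m n + c"
      by (intro lattice_eq_up_to_const) (simp_all add: Xi_system_iff[OF assms(3)] X0)
  next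
    assume "\<exists>c. \<forall>m n. X m n = X0 m n + c"
    then obtain c where "\<And>m n. X m n = X0 m n + c" by blast
    then show "Xi_system u v X" by (simp add: Xi_system_iff[OF assms(3)] X0)
  qed
  then show ?thesis by blast
qed

text \<open>The determinants are antisymmetric in \<open>u\<close> and \<open>v\<close>.\<close>

lemma Xi_system_swap:
  assumes "Xi_system u v X" and "nowhere_zero u" and "nowhere_zero v"
  shows "Xi_system v u (\<lambda>m n. - X m n)"
proof -
  have "X (m + 1) n - X m n = u m n * v (m + 1) n - v m n * u (m + 1) n"
    "X m (n + 1) - X m n = v m n * u m (n + 1) - u m n * v m (n + 1)" for m n
    using assms(1) by (simp_all add: Xi_system_iff[OF assms(2)])
  then show ?thesis
    by (simp add: Xi_system_iff[OF assms(3)]) (simp add: algebra_simps)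
qed

section \<open>Equations satisfied by the transforms\<close>

lemma transformed_potential_phi':
  assumes "moutard_eq F u" and "nowhere_zero u"
  shows "transformed_potential F u m n * phi' u m n = 1 / u m n + 1 / u (m + 1) (n + 1)"
proof -
  have nz: "u m n \<noteq> 0" for m n using assms by (simp add: nowhere_zero_def)
  have "u (m + 1) (n + 1) + u m n = F m n * (u (m + 1) n + u m (n + 1))"
    using assms by (simp add: moutard_eq_def shift1_def shift2_def shift12_def)
  then show ?thesis
    using nz by (simp add: transformed_potential_def phi'_def shift1_def shift2_def shift12_def
        divide_simps)
qed

lemma phi'_nonzero:
  assumes "nowhere_zero u" and "nowhere_zero (phi u)"
  shows "phi' u m n \<noteq> 0"
proof -
  have "u m n \<noteq> 0" for m n using assms by (simp add: nowhere_zero_def)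
  moreover have "u (m + 1) n + u m (n + 1) \<noteq> 0"
    using assms by (simp add: nowhere_zero_def phi_def shift1_def shift2_def)
  ultimately show ?thesis
    by (simp add: phi'_def shift1_def shift2_def divide_simps add.commute)
qed

text \<open>With \<open>y = x/\<phi>\<close> and \<open>y' = x'/\<phi>'\<close>, the closure \<open>\<Delta>\<^sub>1\<Delta>\<^sub>2 y = \<Delta>\<^sub>2\<Delta>\<^sub>1 y\<close>, expressed through \<open>y'\<close>, is
  the equation of \<open>x'\<close>, because \<open>F'\<phi>' = 1/\<theta> + 1/\<theta>\<^bsub>(12)\<^esub>\<close>.\<close>

lemma koenigs_eq_transform:
  assumes "koenigs_transform F u x x'"
  shows "koenigs_eq (transformed_potential F u) x'"
  unfolding koenigs_eq_def
proof (intro allI)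
  fix m n
  define y where "y m n = x m n /\<^sub>R phi u m n" for m n
  define y' where "y' m n = x' m n /\<^sub>R phi' u m n" for m n
  have mou: "moutard_eq F u" and nzu: "nowhere_zero u" and nzp: "nowhere_zero (phi u)"
    using assms by (simp_all add: koenigs_transform_def)
  have nz: "u m n \<noteq> 0" for m n using nzu by (simp add: nowhere_zero_def)
  have d1: "y (m + 1) n - y m n
      = (1 / (u (m + 1) n * u (m + 1) (n + 1))) *\<^sub>R (y' (m + 1) n - y' m n)"
    and d2: "y m (n + 1) - y m n
      = - (1 / (u m (n + 1) * u (m + 1) (n + 1))) *\<^sub>R (y' m (n + 1) - y' m n)" for m n
    using assms nz unfolding koenigs_transform_def diff1_def diff2_def shift1_def shift2_def
      y_def y'_def by simp_all
  have x': "x' m n = phi' u m n *\<^sub>R y' m n" for m n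
    using phi'_nonzero[OF nzu nzp] by (simp add: y'_def)
  let ?k = "u (m + 1) (n + 1)"
  \<comment> \<open>Two paths around a unit square. Each of the four differences of \<open>y\<close>
    carries the factor \<open>1 / ?k\<close>, which the multiplication removes.\<close>
  have "?k *\<^sub>R ((y (m + 1) n - y m n) + (y (m + 1) (n + 1) - y (m + 1) n))
      = ?k *\<^sub>R ((y m (n + 1) - y m n) + (y (m + 1) (n + 1) - y m (n + 1)))"
    by simp
  then have closure: "(1 / u (m + 1) n) *\<^sub>R (y' (m + 1) n - y' m n)
       - (1 / u (m + 2) (n + 1)) *\<^sub>R (y' (m + 1) (n + 1) - y' (m + 1) n)
     = - (1 / u m (n + 1)) *\<^sub>R (y' m (n + 1) - y' m n)
       + (1 / u (m + 1) (n + 2)) *\<^sub>R (y' (m + 1) (n + 1) - y' m (n + 1))"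
    unfolding d1 d2 scaleR_add_right using nz by (simp add: add.assoc)
  have F': "transformed_potential F u m n *\<^sub>R x' m n
      = (1 / u m n + 1 / u (m + 1) (n + 1)) *\<^sub>R y' m n" for m n
    by (simp add: x' transformed_potential_phi'[OF mou nzu])
  show "shift12 x' m n + x' m n =
      shift1 (transformed_potential F u) m n *\<^sub>R shift1 x' m n +
      shift2 (transformed_potential F u) m n *\<^sub>R shift2 x' m n"
    unfolding shift1_def shift2_def shift12_def F' unfolding x' phi'_def shift1_def shift2_def
    using closure by (simp add: algebra_simps add.assoc)
qed

lemma moutard_eq_transform:
  assumes "moutard_eq F u" and "moutard_eq F v" and "nowhere_zero u"
    and "Xi_system u v X" and th: "\<And>m n. u m n * t m n = X m n"
  shows "moutard_eq (transformed_potential F u) t"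
  unfolding moutard_eq_def
proof (intro allI)
  fix m n
  have nz: "u m n \<noteq> 0" for m n using assms by (simp add: nowhere_zero_def)
  then have t: "t m n = X m n / u m n" for m n
    using th[of m n] by (simp add: field_simps)
  have mu: "u (m + 1) (n + 1) = F m n * (u (m + 1) n + u m (n + 1)) - u m n"
    and mv: "v (m + 1) (n + 1) = F m n * (v (m + 1) n + v m (n + 1)) - v m n"
    using assms by (simp_all add: moutard_eq_def shift1_def shift2_def shift12_def eq_diff_eq)
  have X1: "X (m + 1) n - X m n = u m n * v (m + 1) n - v m n * u (m + 1) n"
    and X2: "X m (n + 1) - X m n = v m n * u m (n + 1) - u m n * v m (n + 1)" for m n
    using assms(4) by (simp_all add: Xi_system_iff[OF assms(3)])
  \<comment> \<open>The claim for \<open>t = X / u\<close>, cleared of denominators.\<close>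
  have "u m n * X (m + 1) (n + 1) + u (m + 1) (n + 1) * X m n
      = F m n * (u m (n + 1) * X (m + 1) n + u (m + 1) n * X m (n + 1))"
    using mu mv X1[of m n] X2[of m n] X2[of "m + 1" n] by algebra
  then show "shift12 t m n + t m n =
      transformed_potential F u m n * (shift1 t m n + shift2 t m n)"
    unfolding transformed_potential_def shift1_def shift2_def shift12_def t
    using nz by (simp add: divide_simps) (simp add: mult_ac)
qed

section \<open>Superposition of two transforms\<close>

text \<open>Primes denote values at the neighbouring lattice point; \<open>y = x\<^sup>(\<^sup>1\<^sup>)/\<phi>\<^sup>1\<^sup>(\<^sup>1\<^sup>)\<close> and \<open>z = x\<^sup>(\<^sup>2\<^sup>)/\<phi>\<^sup>2\<^sup>(\<^sup>2\<^sup>)\<close>.\<close>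

lemma superposition_step:
  fixes x x' y y' z z' :: "'v::real_vector"
  assumes dy: "y' - y = b *\<^sub>R (x' /\<^sub>R p' - x /\<^sub>R p)"
    and dz: "z' - z = a *\<^sub>R (x' /\<^sub>R q' - x /\<^sub>R q)"
    and A: "A + a * p = q * w" "A' + a * p' = q' * w"
    and B: "A * b + d * b * p = B * w" "A' * b + d * b * p' = B' * w"
    and nz: "b \<noteq> 0" "p \<noteq> 0" "p' \<noteq> 0" "q \<noteq> 0" "q' \<noteq> 0" "B \<noteq> 0" "B' \<noteq> 0"
  shows "((A' / (p' * q')) *\<^sub>R x' - (A' / B') *\<^sub>R y' + z')
       - ((A / (p * q)) *\<^sub>R x - (A / B) *\<^sub>R y + z)
     = d *\<^sub>R ((p' / B') *\<^sub>R y' - (p / B) *\<^sub>R y)"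
proof -
  \<comment> \<open>The \<open>w\<close> terms cancel through \<open>dy\<close>, the
    \<open>a\<close> terms cancel \<open>z' - z\<close>, and the \<open>d\<close> terms form the
    right-hand side.\<close>
  have Apq: "A / (p * q) = w / p - a / q" "A' / (p' * q') = w / p' - a / q'"
    using A nz by (auto simp: field_simps)
  have AB: "A / B = w / b - d * (p / B)" "A' / B' = w / b - d * (p' / B')"
    using B nz by (simp_all add: divide_simps) algebra+
  have "(w / b) *\<^sub>R (y' - y) = w *\<^sub>R (x' /\<^sub>R p' - x /\<^sub>R p)"
    using nz by (simp add: dy)
  then show ?thesis
    using dz unfolding Apq AB by (simp add: algebra_simps divide_inverse)
qed

text \<open>One of the two claims, for an arbitrary pair \<open>u\<close>, \<open>v\<close>, so that
  it can be reused with the pair exchanged.\<close>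

lemma koenigs_superposition:
  fixes x x1 x2 x12 :: "'v::real_vector lattice"
  assumes k1: "koenigs_transform F u x x1" and k2: "koenigs_transform F v x x2"
    and Xi: "Xi_system u v X" and nzX: "nowhere_zero X"
    and t: "\<And>m n. u m n * t m n = X m n" and s: "\<And>m n. - (v m n * s m n) = X m n"
    and nzt: "nowhere_zero (phi t)"
    and x12: "\<And>m n. x12 m n =
          - ((shift1 X m n * shift2 X m n * phi' s m n * phi' t m n)
               / (phi u m n * phi v m n)) *\<^sub>R x m n
          + (phi' s m n / phi' u m n) *\<^sub>R x1 m n
          + (phi' t m n / phi' v m n) *\<^sub>R x2 m n"
  shows "koenigs_transform (transformed_potential F u) t x1 x12"
proof -
  have mou: "moutard_eq F u" "moutard_eq F v" and nzu: "nowhere_zero u" "nowhere_zero v"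
    and nzp: "nowhere_zero (phi u)" "nowhere_zero (phi v)"
    using k1 k2 by (simp_all add: koenigs_transform_def)
  have u0: "u m n \<noteq> 0" and v0: "v m n \<noteq> 0" and X0: "X m n \<noteq> 0"
    and p0: "phi u m n \<noteq> 0" and q0: "phi v m n \<noteq> 0" for m n
    using nzu nzp nzX by (simp_all add: nowhere_zero_def)
  have t': "t m n = X m n / u m n" and s': "s m n = - X m n / v m n" for m n
    using t[of m n] s[of m n] u0[of m n] v0[of m n] by (simp_all add: field_simps)
  have nzt0: "nowhere_zero t" using X0 u0 by (simp add: nowhere_zero_def t')
  note phi'0 = phi'_nonzero[OF nzu(1) nzp(1)] phi'_nonzero[OF nzu(2) nzp(2)]
    phi'_nonzero[OF nzt0 nzt]
  define A where "A m n = v (m + 1) n * X m (n + 1) + v m (n + 1) * X (m + 1) n" for m n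
  define B where "B m n = u (m + 1) n * X m (n + 1) + u m (n + 1) * X (m + 1) n" for m n
  define y where "y m n = x1 m n /\<^sub>R phi' u m n" for m n
  define z where "z m n = x2 m n /\<^sub>R phi' v m n" for m n
  have phi_t: "phi t m n = B m n / (u (m + 1) n * u m (n + 1))" for m n
    using u0 by (simp add: phi_def shift1_def shift2_def t' B_def divide_simps)
  have phi'_t: "phi' t m n = B m n / (X (m + 1) n * X m (n + 1))" for m n
    using X0 by (simp add: phi'_def shift1_def shift2_def t' B_def divide_simps)
  have phi'_s: "phi' s m n = - A m n / (X (m + 1) n * X m (n + 1))" for m n
    using X0 by (simp add: phi'_def shift1_def shift2_def s' A_def divide_simps)
  have phi'_u: "phi' u m n = phi u m n / (u (m + 1) n * u m (n + 1))" for m n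
    using u0 by (simp add: phi'_def phi_def shift1_def shift2_def divide_simps)
  have B0: "B m n \<noteq> 0" for m n
    using nzt by (auto simp: nowhere_zero_def phi_t)

  have lhs: "x12 m n /\<^sub>R phi' t m n
      = (A m n / (phi u m n * phi v m n)) *\<^sub>R x m n - (A m n / B m n) *\<^sub>R y m n + z m n" for m n
  proof -
    have "inverse (phi' t m n) *
        - ((shift1 X m n * shift2 X m n * phi' s m n * phi' t m n) / (phi u m n * phi v m n))
        = A m n / (phi u m n * phi v m n)"
      using X0 B0 p0 q0 by (simp add: phi'_t phi'_s shift1_def shift2_def)
    moreover have "inverse (phi' t m n) * (phi' s m n / phi' u m n)
        = - (A m n / B m n) * inverse (phi' u m n)"
      using X0 B0 by (simp add: phi'_t phi'_s divide_simps)
    moreover have "inverse (phi' t m n) * (phi' t m n / phi' v m n) = inverse (phi' v m n)"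
      using phi'0(3) by (simp add: divide_inverse)
    ultimately show ?thesis
      by (simp only: x12 y_def z_def scaleR_add_right scaleR_scaleR) simp
  qed
  have rhs: "x1 m n /\<^sub>R phi t m n = (phi u m n / B m n) *\<^sub>R y m n" for m n
    using u0 B0 p0 by (simp add: y_def phi_t phi'_u)

  have mu: "u (m + 1) (n + 1) = F m n * (u (m + 1) n + u m (n + 1)) - u m n"
    and mv: "v (m + 1) (n + 1) = F m n * (v (m + 1) n + v m (n + 1)) - v m n" for m n
    using mou by (simp_all add: moutard_eq_def shift1_def shift2_def shift12_def eq_diff_eq)
  have X1: "X (m + 1) n - X m n = u m n * v (m + 1) n - v m n * u (m + 1) n"
    and X2: "X m (n + 1) - X m n = v m n * u m (n + 1) - u m n * v m (n + 1)" for m n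
    using Xi by (simp_all add: Xi_system_iff[OF nzu(1)])
  have p: "phi u m n = u (m + 1) n + u m (n + 1)" and q: "phi v m n = v (m + 1) n + v m (n + 1)"
    for m n by (simp_all add: phi_def shift1_def shift2_def)

  have D1: "diff1 (\<lambda>m n. x12 m n /\<^sub>R phi' t m n) m n
      = shift1 (\<lambda>m n. t m n * shift2 t m n) m n *\<^sub>R diff1 (\<lambda>m n. x1 m n /\<^sub>R phi t m n) m n" for m n
    unfolding diff1_def shift1_def shift2_def lhs rhs
  proof (rule superposition_step)
    \<comment> \<open>\<open>?a\<close>, \<open>?b\<close>, \<open>?d\<close> are the
      first-direction coefficients of the transforms via \<open>v\<close>, \<open>u\<close>,
      \<open>t\<close>.\<close>
    let ?a = "v (m + 1) n * v (m + 1) (n + 1)" and ?b = "u (m + 1) n * u (m + 1) (n + 1)"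
    let ?w = "X (m + 1) n + v (m + 1) n * u (m + 1) (n + 1)"
    let ?d = "t (m + 1) n * t (m + 1) (n + 1)"
    show "y (m + 1) n - y m n = ?b *\<^sub>R (x (m + 1) n /\<^sub>R phi u (m + 1) n - x m n /\<^sub>R phi u m n)"
      and "z (m + 1) n - z m n = ?a *\<^sub>R (x (m + 1) n /\<^sub>R phi v (m + 1) n - x m n /\<^sub>R phi v m n)"
      using k1 k2 unfolding koenigs_transform_def diff1_def shift1_def shift2_def y_def z_def
      by simp_all
    have db: "?d * ?b = X (m + 1) n * X (m + 1) (n + 1)"
      by (simp add: t[symmetric])
    \<comment> \<open>This is \<open>v (m + 1) n\<close> times the closedness identity of the
      potential; at the neighbour, the increments of \<open>X\<close> from there suffice.\<close>
    show "A m n + ?a * phi u m n = phi v m n * ?w"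
      unfolding A_def p q using mu[of m n] mv[of m n] X1[of m n] X2[of m n] by algebra
    show "A (m + 1) n + ?a * phi u (m + 1) n = phi v (m + 1) n * ?w"
      unfolding A_def p q using X1[of "m + 1" n] X2[of "m + 1" n] by algebra
    show "A m n * ?b + ?d * ?b * phi u m n = B m n * ?w"
      unfolding db A_def B_def p
      using mu[of m n] mv[of m n] X1[of m n] X2[of m n] X2[of "m + 1" n] by algebra
    show "A (m + 1) n * ?b + ?d * ?b * phi u (m + 1) n = B (m + 1) n * ?w"
      unfolding db A_def B_def p using X1[of "m + 1" n] X2[of "m + 1" n] by algebra
  qed (use u0 p0 q0 B0 in simp_all)

  have D2: "diff2 (\<lambda>m n. x12 m n /\<^sub>R phi' t m n) m n
      = - shift2 (\<lambda>m n. t m n * shift1 t m n) m n *\<^sub>R diff2 (\<lambda>m n. x1 m n /\<^sub>R phi t m n) m n" for m n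
    unfolding diff2_def shift1_def shift2_def lhs rhs
  proof (rule superposition_step)
    \<comment> \<open>The minus sign of the second Koenigs equation is absorbed into all three
      coefficients, so \<open>?d * ?b\<close> keeps its sign.\<close>
    let ?a = "- (v m (n + 1) * v (m + 1) (n + 1))" and ?b = "- (u m (n + 1) * u (m + 1) (n + 1))"
    let ?w = "X m (n + 1) - v m (n + 1) * u (m + 1) (n + 1)"
    let ?d = "- (t m (n + 1) * t (m + 1) (n + 1))"
    show "y m (n + 1) - y m n = ?b *\<^sub>R (x m (n + 1) /\<^sub>R phi u m (n + 1) - x m n /\<^sub>R phi u m n)"
      and "z m (n + 1) - z m n = ?a *\<^sub>R (x m (n + 1) /\<^sub>R phi v m (n + 1) - x m n /\<^sub>R phi v m n)"
      using k1 k2 unfolding koenigs_transform_def diff2_def shift1_def shift2_def y_def z_def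
      by simp_all
    have db: "?d * ?b = X m (n + 1) * X (m + 1) (n + 1)"
      by (simp add: t[symmetric])
    show "A m n + ?a * phi u m n = phi v m n * ?w"
      unfolding A_def p q using mu[of m n] mv[of m n] X1[of m n] X2[of m n] by algebra
    show "A m (n + 1) + ?a * phi u m (n + 1) = phi v m (n + 1) * ?w"
      unfolding A_def p q using X1[of m "n + 1"] X2[of m "n + 1"] by algebra
    show "A m n * ?b + ?d * ?b * phi u m n = B m n * ?w"
      unfolding db A_def B_def p
      using mu[of m n] mv[of m n] X1[of m n] X2[of m n] X1[of m "n + 1"] by algebra
    show "A m (n + 1) * ?b + ?d * ?b * phi u m (n + 1) = B m (n + 1) * ?w"
      unfolding db A_def B_def p using X1[of m "n + 1"] X2[of m "n + 1"] by algebra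
  qed (use u0 p0 q0 B0 in simp_all)

  show ?thesis
    unfolding koenigs_transform_def
    using koenigs_eq_transform[OF k1] moutard_eq_transform[OF mou nzu(1) Xi t] nzt0 nzt D1 D2
    by blast
qed

theorem proposition5p1:
  fixes F \<theta>1 \<theta>2 :: "real lattice"
    and x x1 x2 :: "(real ^ 'n) lattice"
  assumes "nowhere_zero x"
    and "koenigs_eq F x"
    and "moutard_eq F \<theta>1" and "moutard_eq F \<theta>2"
    and "nowhere_zero \<theta>1" and "nowhere_zero \<theta>2"
    and "nowhere_zero (phi \<theta>1)" and "nowhere_zero (phi \<theta>2)"
    and "koenigs_transform F \<theta>1 x x1"
    and "koenigs_transform F \<theta>2 x x2"
  shows "(\<exists>\<Xi>0. \<forall>\<Xi>. Xi_system \<theta>1 \<theta>2 \<Xi> \<longleftrightarrow> (\<exists>c. \<forall>m n. \<Xi> m n = \<Xi>0 m n + c)) \<and>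
    (\<forall>\<Xi> \<theta>21 \<theta>12 x12.
       Xi_system \<theta>1 \<theta>2 \<Xi> \<and>
       (\<forall>m n. \<theta>1 m n * \<theta>21 m n = \<Xi> m n) \<and>
       (\<forall>m n. - (\<theta>2 m n * \<theta>12 m n) = \<Xi> m n) \<and>
       nowhere_zero \<Xi> \<and>
       nowhere_zero (phi \<theta>21) \<and> nowhere_zero (phi \<theta>12) \<and>
       nowhere_zero (phi' \<theta>21) \<and> nowhere_zero (phi' \<theta>12) \<and>
       (\<forall>m n. x12 m n =
          - ((shift1 \<Xi> m n * shift2 \<Xi> m n * phi' \<theta>12 m n * phi' \<theta>21 m n)
               / (phi \<theta>1 m n * phi \<theta>2 m n)) *\<^sub>R x m n
          + (phi' \<theta>12 m n / phi' \<theta>1 m n) *\<^sub>R x1 m n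
          + (phi' \<theta>21 m n / phi' \<theta>2 m n) *\<^sub>R x2 m n) \<longrightarrow>
       koenigs_transform (transformed_potential F \<theta>1) \<theta>21 x1 x12 \<and>
       koenigs_transform (transformed_potential F \<theta>2) \<theta>12 x2 x12)"
proof (intro conjI allI impI; (elim conjE)?)
  show "\<exists>\<Xi>0. \<forall>\<Xi>. Xi_system \<theta>1 \<theta>2 \<Xi> \<longleftrightarrow> (\<exists>c. \<forall>m n. \<Xi> m n = \<Xi>0 m n + c)"
    using assms(3-5) by (rule Xi_system_solvable)
next
  fix \<Xi> \<theta>21 \<theta>12 :: "real lattice" and x12 :: "(real ^ 'n) lattice"
  assume Xi: "Xi_system \<theta>1 \<theta>2 \<Xi>" "nowhere_zero \<Xi>"
    and t: "\<forall>m n. \<theta>1 m n * \<theta>21 m n = \<Xi> m n" "\<forall>m n. - (\<theta>2 m n * \<theta>12 m n) = \<Xi> m n"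
    and nz: "nowhere_zero (phi \<theta>21)" "nowhere_zero (phi \<theta>12)"
    and x12: "\<forall>m n. x12 m n =
          - ((shift1 \<Xi> m n * shift2 \<Xi> m n * phi' \<theta>12 m n * phi' \<theta>21 m n)
               / (phi \<theta>1 m n * phi \<theta>2 m n)) *\<^sub>R x m n
          + (phi' \<theta>12 m n / phi' \<theta>1 m n) *\<^sub>R x1 m n
          + (phi' \<theta>21 m n / phi' \<theta>2 m n) *\<^sub>R x2 m n"
  show "koenigs_transform (transformed_potential F \<theta>1) \<theta>21 x1 x12"
    using koenigs_superposition[OF assms(9,10) Xi] t nz(1) x12 by blast
  show "koenigs_transform (transformed_potential F \<theta>2) \<theta>12 x2 x12"
  \<comment> \<open>The formula for \<open>x12\<close> is invariant under the exchange, since it is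
    even in the potential.\<close>
  proof (rule koenigs_superposition[OF assms(10,9) Xi_system_swap[OF Xi(1) assms(5,6)]])
    show "nowhere_zero (\<lambda>m n. - \<Xi> m n)" using Xi(2) by (simp add: nowhere_zero_def)
    show "\<theta>2 m n * \<theta>12 m n = - \<Xi> m n" "- (\<theta>1 m n * \<theta>21 m n) = - \<Xi> m n" for m n
      using t by (metis minus_minus)+
    show "x12 m n = - ((shift1 (\<lambda>m n. - \<Xi> m n) m n * shift2 (\<lambda>m n. - \<Xi> m n) m n
               * phi' \<theta>21 m n * phi' \<theta>12 m n) / (phi \<theta>2 m n * phi \<theta>1 m n)) *\<^sub>R x m n
          + (phi' \<theta>21 m n / phi' \<theta>2 m n) *\<^sub>R x2 m n
          + (phi' \<theta>12 m n / phi' \<theta>1 m n) *\<^sub>R x1 m n" for m n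
      using x12 by (simp add: shift1_def shift2_def mult_ac add_ac)
  qed (fact nz(2))
qed

end
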